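(* Suppose $n$ and $k$ are integers satisfying $k > n \geq 2$. If $n$ is odd and $k = n+1$, then the maximal girth of a $k$-regular induced subgraph of the $n$-dimensional grid is $6$, which is attained by only one such subgraph up to isometry. Otherwise, the maximal girth of a $k$-regular induced subgraph of the $n$-dimensional grid is $4$.
   Context: The $n$-dimensional grid is the unit-distance graph on the integer lattice $\mathbb{Z}^n$, i.e. the graph with vertex set $\mathbb{Z}^n$ in which two points are adjacent if and only if their Euclidean distance is $1$. An induced subgraph $H$ of a graph $G$ is a subgraph that contains an edge between any two vertices in its vertex set that are adjacent in $G$. A graph is $k$-regular if every vertex has exactly $k$ neighbours; the null graph (with no vertices) is not considered a valid example of a $k$-regular graph. Subgraphs may be infinite. The girth of a graph is the length of its shortest cycle. Two subgraphs of the $n$-dimensional grid are the same up to isometry if some isometry maps one onto the other.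
   Formalization: In the "otherwise" case the formal theorem additionally assumes k ≤ 2n, since every vertex of the n-dimensional grid has only 2n neighbours and for k > 2n (e.g. n = 2, k = 5) no k-regular subgraph exists, so there is no maximal girth. *)

theory Defs
  imports "HOL-Analysis.Analysis" "HOL-Library.Extended_Nat"
begin

datatype 'a graph = Graph (verts: "'a set") (edges: "'a set set")

definition adjacent :: "'a graph \<Rightarrow> 'a \<Rightarrow> 'a \<Rightarrow> bool" where
  "adjacent G u v \<longleftrightarrow> {u, v} \<in> edges G"

definition subgraph :: "'a graph \<Rightarrow> 'a graph \<Rightarrow> bool" where
  "subgraph H G \<longleftrightarrow>
     verts H \<subseteq> verts G \<and> edges H \<subseteq> edges G \<and> (\<forall>e\<in>edges H. e \<subseteq> verts H)"

definition induced_subgraph :: "'a graph \<Rightarrow> 'a graph \<Rightarrow> bool" where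
  "induced_subgraph H G \<longleftrightarrow>
     subgraph H G \<and> (\<forall>u\<in>verts H. \<forall>v\<in>verts H. adjacent G u v \<longrightarrow> adjacent H u v)"

definition neighbours :: "'a graph \<Rightarrow> 'a \<Rightarrow> 'a set" where
  "neighbours G v = {u \<in> verts G. adjacent G v u}"

definition regular :: "'a graph \<Rightarrow> nat \<Rightarrow> bool" where
  "regular G k \<longleftrightarrow>
     verts G \<noteq> {} \<and> (\<forall>v\<in>verts G. finite (neighbours G v) \<and> card (neighbours G v) = k)"

text \<open>A cycle is given by its vertices in cyclic order.\<close>

definition cycle :: "'a graph \<Rightarrow> 'a list \<Rightarrow> bool" where
  "cycle G c \<longleftrightarrow>
     length c \<ge> 3 \<and> distinct c \<and> set c \<subseteq> verts G \<and>
     (\<forall>i<length c. adjacent G (c ! i) (c ! (Suc i mod length c)))"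

text \<open>Acyclic graphs have girth \<open>\<infinity>\<close>, the infimum of the empty set.\<close>

definition girth :: "'a graph \<Rightarrow> enat" where
  "girth G = (INF c\<in>{c. cycle G c}. enat (length c))"

text \<open>Euclidean distance on the integer lattice, through its embedding into real space.\<close>

definition lattice_dist :: "int ^ 'n \<Rightarrow> int ^ 'n \<Rightarrow> real" where
  "lattice_dist x y = dist (\<chi> i. real_of_int (x $ i)) (\<chi> i. real_of_int (y $ i))"

definition grid :: "(int ^ 'n) graph" where
  "grid = Graph UNIV {{x, y} | x y. lattice_dist x y = 1}"

definition regular_induced_subgraphs :: "'a graph \<Rightarrow> nat \<Rightarrow> 'a graph set" where
  "regular_induced_subgraphs G k = {H. induced_subgraph H G \<and> regular H k}"

definition is_maximal_girth :: "'a graph set \<Rightarrow> enat \<Rightarrow> bool" where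
  "is_maximal_girth S g \<longleftrightarrow> (\<exists>H\<in>S. girth H = g) \<and> (\<forall>H\<in>S. girth H \<le> g)"

definition isometry :: "(int ^ 'n \<Rightarrow> int ^ 'n) \<Rightarrow> bool" where
  "isometry f \<longleftrightarrow> bij f \<and> (\<forall>x y. lattice_dist (f x) (f y) = lattice_dist x y)"

definition same_up_to_isometry :: "(int ^ 'n) graph \<Rightarrow> (int ^ 'n) graph \<Rightarrow> bool" where
  "same_up_to_isometry H H' \<longleftrightarrow>
     (\<exists>f. isometry f \<and> verts H' = f ` verts H \<and> edges H' = (\<lambda>e. f ` e) ` edges H)"

text \<open>
  Every vertex of the grid has at most \<open>2 n\<close> neighbours, so for \<open>k > 2 n\<close> there are no
  \<open>k\<close>-regular subgraphs and hence no maximal girth.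
\<close>

lemma unit_distance_subset:
  fixes v :: "int ^ 'n"
  shows "{u. lattice_dist v u = 1} \<subseteq> (\<lambda>(i, s). v + axis i s) ` (UNIV \<times> {1, -1})"
proof
  fix u assume "u \<in> {u. lattice_dist v u = 1}"
  then have "real_of_int (\<Sum>i\<in>UNIV. (v $ i - u $ i)\<^sup>2) = 1"
    by (simp add: lattice_dist_def dist_vec_def L2_set_def dist_real_def)
  then have s: "(\<Sum>i\<in>UNIV. (v $ i - u $ i)\<^sup>2) = 1"
    by linarith
  then obtain i where i: "v $ i - u $ i \<noteq> 0"
    by force
  have eq: "(v $ i - u $ i)\<^sup>2 + (\<Sum>j\<in>UNIV - {i}. (v $ j - u $ j)\<^sup>2) = 1"
    using s by (simp add: sum.remove[of UNIV i])
  have pos: "(v $ i - u $ i)\<^sup>2 \<ge> 1"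
    using i by (smt (verit) zero_less_power2)
  have nonneg: "(\<Sum>j\<in>UNIV - {i}. (v $ j - u $ j)\<^sup>2) \<ge> 0"
    by (simp add: sum_nonneg)
  have "(\<Sum>j\<in>UNIV - {i}. (v $ j - u $ j)\<^sup>2) = 0"
    using eq pos nonneg by linarith
  then have other: "v $ j = u $ j" if "j \<noteq> i" for j
    using that by (simp add: sum_nonneg_eq_0_iff)
  have "(u $ i - v $ i)\<^sup>2 = 1"
    using eq pos nonneg by (simp add: power2_commute)
  then have "u $ i - v $ i \<in> {1, -1}"
    by (simp add: power2_eq_1_iff)
  moreover have "u = v + axis i (u $ i - v $ i)"
    using other by (auto simp: vec_eq_iff axis_def)
  ultimately show "u \<in> (\<lambda>(i, s). v + axis i s) ` (UNIV \<times> {1, -1})"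
    by (metis (mono_tags, lifting) SigmaI UNIV_I case_prod_conv rev_image_eqI)
qed

lemma regular_induced_subgraph_grid_degree_le:
  assumes "H \<in> regular_induced_subgraphs (grid :: (int ^ 'n) graph) k"
  shows "k \<le> 2 * CARD('n)"
proof -
  let ?A = "UNIV \<times> {1, -1} :: ('n \<times> int) set"
  from assms obtain v where v: "v \<in> verts H" and k: "card (neighbours H v) = k"
    by (auto simp: regular_induced_subgraphs_def regular_def)
  have "neighbours H v \<subseteq> {u. lattice_dist v u = 1}"
    using assms by (fastforce simp: regular_induced_subgraphs_def induced_subgraph_def
        subgraph_def neighbours_def adjacent_def grid_def doubleton_eq_iff lattice_dist_def dist_commute)
  then have "neighbours H v \<subseteq> (\<lambda>(i, s). v + axis i s) ` ?A"
    using unit_distance_subset[of v] by blast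
  then have "k \<le> card ((\<lambda>(i, s). v + axis i s) ` ?A)"
    unfolding k[symmetric] by (intro card_mono) auto
  also have "\<dots> \<le> card ?A"
    by (intro card_image_le) auto
  also have "\<dots> = 2 * CARD('n)"
    by (simp add: card_cartesian_product)
  finally show ?thesis .
qed

end

theory Submission imports Defs begin

text \<open>
  The grid is bipartite, so girths are even. Let \<open>D v\<close> be the set of the \<open>k\<close> directions in which a
  vertex \<open>v\<close> has neighbours. Without 4-cycles, \<open>D v\<close> and \<open>D (v + d)\<close> for \<open>d \<in> D v\<close> share at most
  \<open>d\<close> and \<open>- d\<close>; as both lie in a set of \<open>2 n\<close> directions, \<open>2 k \<le> 2 n + 2\<close>. Hence \<open>k = n + 1\<close> and
  equality holds throughout: \<open>D v\<close> is closed under negation, so that \<open>n + 1 = 2 m\<close> is even, and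
  \<open>D (v + d)\<close> consists of \<open>d\<close>, \<open>- d\<close> and the complement of \<open>D v\<close>. These rules determine the
  subgraph from one vertex: up to translation it consists of the points with \<open>m\<close> or \<open>m - 1\<close> odd
  coordinates. In all other cases the maximal girth 4 is attained by restricting \<open>2 n - k\<close> of the
  coordinates to \<open>{0, 1}\<close>.
\<close>

section \<open>Unit directions and adjacency of lattice points\<close>

text \<open>A direction is an axis with a sign. As a finite type of 2n elements it supports counting
  via \<open>UNIV\<close>, and reversal is negation of the second component.\<close>

definition unit_vec :: "'n \<times> bool \<Rightarrow> int ^ 'n" where
  "unit_vec d = axis (fst d) (if snd d then 1 else - 1)"

lemma unit_vec_nth [simp]:
  "unit_vec (i, b) $ j = (if j = i then if b then 1 else - 1 else 0)"
  by (simp add: unit_vec_def axis_def)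

lemma unit_vec_opposite: "unit_vec (i, \<not> b) = - unit_vec (i, b)"
  by (simp add: vec_eq_iff)

lemma unit_vec_inject [simp]: "unit_vec d = unit_vec e \<longleftrightarrow> d = e"
proof
  assume eq: "unit_vec d = unit_vec e"
  obtain i b j c where d: "d = (i, b)" and e: "e = (j, c)"
    by fastforce
  show "d = e"
    using arg_cong[OF eq, of "\<lambda>v. v $ i"] by (auto simp: d e split: if_splits)
qed simp

lemma unit_vec_neq_0 [simp]: "unit_vec d \<noteq> 0"
  by (cases d) (auto simp: vec_eq_iff)

lemma lattice_dist_eq_1_iff:
  fixes u v :: "int ^ 'n"
  shows "lattice_dist u v = 1 \<longleftrightarrow> (\<exists>d. v = u + unit_vec d)"
proof
  assume "lattice_dist u v = 1"
  then obtain i s where "v = u + axis i s" "s = 1 \<or> s = - 1"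
    using unit_distance_subset[of u] by fastforce
  then have "v = u + unit_vec (i, s = 1)"
    by (auto simp: unit_vec_def)
  then show "\<exists>d. v = u + unit_vec d" ..
next
  assume "\<exists>d. v = u + unit_vec d"
  then obtain i b where v: "v = u + unit_vec (i, b)"
    by fastforce
  have "(\<Sum>j\<in>UNIV. (real_of_int (u $ j) - real_of_int (v $ j))\<^sup>2)
      = (\<Sum>j\<in>UNIV. if j = i then 1 else 0)"
    by (intro sum.cong) (auto simp: v)
  then show "lattice_dist u v = 1"
    by (simp add: lattice_dist_def dist_vec_def L2_set_def dist_real_def)
qed

section \<open>Induced subgraphs as vertex sets\<close>

definition spanned :: "(int ^ 'n) set \<Rightarrow> (int ^ 'n) graph" where
  "spanned V = Graph V {{x, y} | x y. x \<in> V \<and> y \<in> V \<and> lattice_dist x y = 1}"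

lemma verts_spanned [simp]: "verts (spanned V) = V"
  by (simp add: spanned_def)

lemma lattice_dist_commute: "lattice_dist x y = lattice_dist y x"
  by (simp add: lattice_dist_def dist_commute)

lemma adjacent_grid: "adjacent grid u v \<longleftrightarrow> lattice_dist u v = 1"
  by (auto simp: adjacent_def grid_def doubleton_eq_iff lattice_dist_commute)

lemma adjacent_spanned:
  "adjacent (spanned V) u v \<longleftrightarrow> u \<in> V \<and> v \<in> V \<and> (\<exists>d. v = u + unit_vec d)"
  unfolding lattice_dist_eq_1_iff[symmetric]
  by (auto simp: adjacent_def spanned_def doubleton_eq_iff lattice_dist_commute)

text \<open>An induced subgraph is determined by its vertex set, so all later arguments concern a
  set \<open>V\<close> of lattice points.\<close>

lemma induced_subgraph_grid_iff:
  "induced_subgraph H (grid :: (int ^ 'n) graph) \<longleftrightarrow> H = spanned (verts H)"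
proof
  assume H: "induced_subgraph H (grid :: (int ^ 'n) graph)"
  have "edges H = edges (spanned (verts H))"
  proof (intro set_eqI iffI)
    fix e assume e: "e \<in> edges H"
    then have "e \<in> edges (grid :: (int ^ 'n) graph)" "e \<subseteq> verts H"
      using H by (auto simp: induced_subgraph_def subgraph_def)
    then show "e \<in> edges (spanned (verts H))"
      by (auto simp: grid_def spanned_def)
  next
    fix e assume "e \<in> edges (spanned (verts H))"
    then obtain x y where "e = {x, y}" "x \<in> verts H" "y \<in> verts H" "lattice_dist x y = 1"
      by (auto simp: spanned_def)
    then show "e \<in> edges H"
      using H by (auto simp: induced_subgraph_def adjacent_grid adjacent_def[of H])
  qed
  then show "H = spanned (verts H)"
    by (cases H) (simp add: spanned_def)
next
  assume "H = spanned (verts H)"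
  moreover have "induced_subgraph (spanned V) (grid :: (int ^ 'n) graph)" for V
    by (auto simp: induced_subgraph_def subgraph_def adjacent_grid adjacent_spanned
        lattice_dist_eq_1_iff) (auto simp: spanned_def grid_def)
  ultimately show "induced_subgraph H grid"
    by metis
qed

text \<open>Recording directions instead of neighbours puts the neighbourhoods of different vertices
  into one common set, where they can be compared.\<close>

definition dirs :: "(int ^ 'n) set \<Rightarrow> int ^ 'n \<Rightarrow> ('n \<times> bool) set" where
  "dirs V v = {d. v + unit_vec d \<in> V}"

lemma regular_spanned_iff:
  fixes V :: "(int ^ 'n) set"
  shows "regular (spanned V) k \<longleftrightarrow> V \<noteq> {} \<and> (\<forall>v\<in>V. card (dirs V v) = k)"
proof -
  have "neighbours (spanned V) v = (\<lambda>d. v + unit_vec d) ` dirs V v" if "v \<in> V" for v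
    using that by (auto simp: neighbours_def adjacent_spanned dirs_def)
  then have "finite (neighbours (spanned V) v)"
    "card (neighbours (spanned V) v) = card (dirs V v)" if "v \<in> V" for v
    using that by (auto simp: card_image inj_on_def)
  then show ?thesis
    by (auto simp: regular_def)
qed

lemma regular_induced_subgraphs_grid:
  "regular_induced_subgraphs (grid :: (int ^ 'n) graph) k
    = spanned ` {V. V \<noteq> {} \<and> (\<forall>v\<in>V. card (dirs V v) = k)}"
  unfolding regular_induced_subgraphs_def induced_subgraph_grid_iff
  by (auto simp: regular_spanned_iff[symmetric])

section \<open>Parity of cycles and unit squares\<close>

text \<open>Directions on different axes are neither equal nor opposite, so the four points involved
  are the corners of a unit square. The 4-cycles of the grid are exactly these squares.\<close>

definition square_free :: "(int ^ 'n) set \<Rightarrow> bool" where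
  "square_free V \<longleftrightarrow> (\<forall>v\<in>V. \<forall>d\<in>dirs V v. \<forall>e\<in>dirs V v.
     fst d \<noteq> fst e \<longrightarrow> v + unit_vec d + unit_vec e \<notin> V)"

text \<open>Every edge flips the parity \<open>p\<close> of the coordinate sum. Going once around,
  the edge from the last vertex back to the first forces an even length.\<close>

lemma even_length_cycle:
  assumes "cycle (spanned V) c"
  shows "even (length c)"
proof -
  define p where "p v = odd (\<Sum>i\<in>UNIV. v $ i)" for v :: "int ^ 'a"
  have step: "p (v + unit_vec d) \<longleftrightarrow> \<not> p v" for v d
  proof (cases d)
    case (Pair i b)
    have "(\<Sum>j\<in>UNIV. (v + unit_vec d) $ j) = (\<Sum>j\<in>UNIV. v $ j) + (if b then 1 else - 1)"
      by (simp add: Pair sum.distrib)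
    then show ?thesis
      by (simp add: p_def)
  qed
  have adj: "p (c ! (Suc i mod length c)) \<longleftrightarrow> \<not> p (c ! i)" if "i < length c" for i
    using assms that step by (fastforce simp: cycle_def adjacent_spanned)
  have alt: "p (c ! i) \<longleftrightarrow> (p (c ! 0) \<longleftrightarrow> even i)" if "i < length c" for i
    using that
  proof (induction i)
    case (Suc i)
    then show ?case
      using adj[of i] by simp
  qed simp
  have "length c \<ge> 3"
    using assms by (simp add: cycle_def)
  then have "length c - 1 < length c" "Suc (length c - 1) = length c"
    by auto
  then show ?thesis
    using adj[of "length c - 1"] alt[of "length c - 1"] by (metis even_Suc mod_self)
qed

lemma girth_le: "cycle G c \<Longrightarrow> girth G \<le> enat (length c)"
  unfolding girth_def by (intro INF_lower) simp

lemma girth_spanned_ge_4: "girth (spanned V) \<ge> 4"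
proof -
  have "4 \<le> enat (length c)" if "cycle (spanned V) c" for c
  proof -
    have "length c \<ge> 4"
      using even_length_cycle[OF that] that by (cases "length c = 3") (auto simp: cycle_def)
    then show ?thesis
      by (metis enat_ord_simps(1) numeral_eq_enat)
  qed
  then show ?thesis
    unfolding girth_def by (intro INF_greatest) simp
qed

text \<open>This compares two paths of length two with common ends. A non-zero sum of two unit
  vectors determines the summands up to order, so a different path takes the same steps in the
  opposite order; steps on one axis would be equal or cancel.\<close>

lemma unit_vec_add_eq:
  assumes "unit_vec p + unit_vec r = unit_vec q + unit_vec s"
    and "p \<noteq> q" and "unit_vec p + unit_vec r \<noteq> 0"
  shows "r = q" "fst p \<noteq> fst q"
proof -
  obtain i a j b k c l d where [simp]: "p = (i, a)" "r = (j, b)" "q = (k, c)" "s = (l, d)"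
    by (metis surj_pair)
  have nth: "unit_vec p $ x + unit_vec r $ x = unit_vec q $ x + unit_vec s $ x" for x
    using assms(1) by (metis vector_add_component)
  have nz: "\<not> (i = j \<and> a \<noteq> b)"
    using assms(3) unit_vec_opposite[of i a] by (cases a; cases b) auto
  have "r = q \<and> fst p \<noteq> fst q"
    using nth[of i] nth[of j] nth[of k] nz assms(2)
    by (auto split: if_splits)
  then show "r = q" "fst p \<noteq> fst q"
    by blast+
qed

lemma lattice_dist_unit_vec [simp]:
  "lattice_dist v (v + unit_vec d) = 1" "lattice_dist (v + unit_vec d) v = 1"
  using lattice_dist_eq_1_iff lattice_dist_commute by metis+

text \<open>For explicit lists, consecutive pairs and one closing edge are easier to check than
  indices modulo the length.\<close>

lemma cycle_spannedI:
  assumes "length c \<ge> 3" "distinct c" "set c \<subseteq> V"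
    and succ: "successively (\<lambda>u v. lattice_dist u v = 1) c" and "lattice_dist (last c) (hd c) = 1"
  shows "cycle (spanned V) c"
proof -
  have "lattice_dist (c ! i) (c ! (Suc i mod length c)) = 1" if "i < length c" for i
  proof (cases "Suc i < length c")
    case True
    then show ?thesis
      using succ by (simp add: successively_conv_nth)
  next
    case False
    then have i: "length c = Suc i"
      using that by simp
    then have "c \<noteq> []"
      by auto
    then show ?thesis
      using assms(5) i by (simp add: last_conv_nth hd_conv_nth)
  qed
  moreover have "c ! i \<in> V \<and> c ! (Suc i mod length c) \<in> V" if "i < length c" for i
  proof -
    have "Suc i mod length c < length c"
      using that by (intro mod_less_divisor) linarith
    then show ?thesis
      using that assms(3) by (meson nth_mem subsetD)
  qed
  ultimately show ?thesis
    unfolding cycle_def adjacent_spanned lattice_dist_eq_1_iff[symmetric]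
    using assms(3) by (intro conjI allI impI assms(1,2)) auto
qed

lemma not_square_free_girth_le_4:
  assumes "\<not> square_free V"
  shows "girth (spanned V) \<le> 4"
proof -
  obtain v d e where v: "v \<in> V" "v + unit_vec d \<in> V" "v + unit_vec e \<in> V"
    and w: "v + unit_vec d + unit_vec e \<in> V" and ne: "fst d \<noteq> fst e"
    using assms by (auto simp: square_free_def dirs_def)
  have sum: "unit_vec d + unit_vec e \<noteq> 0"
  proof
    assume "unit_vec d + unit_vec e = 0"
    then have "unit_vec d $ fst d + unit_vec e $ fst d = 0"
      by (metis vector_add_component zero_index)
    then show False
      using ne by (cases d; cases e) (auto split: if_splits)
  qed
  let ?c = "[v, v + unit_vec d, v + unit_vec d + unit_vec e, v + unit_vec e]"
  have "cycle (spanned V) ?c"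
  proof (rule cycle_spannedI)
    show "distinct ?c"
      using ne sum by (auto simp: add.assoc)
    have "lattice_dist (v + unit_vec d + unit_vec e) (v + unit_vec e) = 1"
      using lattice_dist_unit_vec(2)[of "v + unit_vec e" d] by (simp add: ac_simps)
    then show "successively (\<lambda>u v. lattice_dist u v = 1) ?c"
      by simp
  qed (use v w in auto)
  moreover have "enat (length ?c) = 4"
    by (simp add: numeral_eq_enat)
  ultimately show ?thesis
    using girth_le by metis
qed

text \<open>By parity only length 4 has to be excluded. A 4-cycle consists of two paths between
  opposite corners, and \<open>unit_vec_add_eq\<close> turns them into a unit square.\<close>

lemma square_free_girth_ge_6:
  assumes "square_free V"
  shows "girth (spanned V) \<ge> 6"
proof -
  have "6 \<le> enat (length c)" if c: "cycle (spanned V) c" for c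
  proof -
    have "length c \<noteq> 4"
    proof
      assume len: "length c = 4"
      have adj: "lattice_dist (c ! i) (c ! (Suc i mod 4)) = 1" if "i < 4" for i
      proof -
        have "adjacent (spanned V) (c ! i) (c ! (Suc i mod 4))"
          using c that unfolding cycle_def len by simp
        then show ?thesis
          unfolding adjacent_spanned lattice_dist_eq_1_iff by blast
      qed
      have "length c = Suc (Suc (Suc (Suc 0)))"
        using len by simp
      then obtain x0 x1 x2 x3 where c': "c = [x0, x1, x2, x3]"
        by (auto simp: length_Suc_conv)
      have "lattice_dist x0 x1 = 1" "lattice_dist x1 x2 = 1" "lattice_dist x2 x3 = 1"
        "lattice_dist x3 x0 = 1"
        using adj[of 0] adj[of 1] adj[of 2] adj[of 3] unfolding c' by simp_all
      \<comment> \<open>Two edges are reversed so that both paths lead from \<open>x0\<close> to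
        \<open>x2\<close>.\<close>
      then have "lattice_dist x0 x1 = 1" "lattice_dist x1 x2 = 1" "lattice_dist x3 x2 = 1"
        "lattice_dist x0 x3 = 1"
        by (metis lattice_dist_commute)+
      then obtain p r q s where x: "x1 = x0 + unit_vec p" "x2 = x1 + unit_vec r"
        "x3 = x0 + unit_vec q" "x2 = x3 + unit_vec s"
        unfolding lattice_dist_eq_1_iff by blast
      have mem: "x0 \<in> V" "x1 \<in> V" "x2 \<in> V" "x3 \<in> V" and dist: "x1 \<noteq> x3" "x0 \<noteq> x2"
        using c unfolding cycle_def c' by simp_all
      have x2: "x2 = x0 + (unit_vec p + unit_vec r)" "x2 = x0 + (unit_vec q + unit_vec s)"
        using x(1,2) x(3,4) by (metis add.assoc)+
      have "unit_vec p + unit_vec r = unit_vec q + unit_vec s"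
        using x2 by (metis add_left_cancel)
      moreover have "p \<noteq> q" "unit_vec p + unit_vec r \<noteq> 0"
        using dist x(1,3) x2(1) by auto
      ultimately have "r = q" "fst p \<noteq> fst q"
        using unit_vec_add_eq[of p r q s] by blast+
      moreover have "p \<in> dirs V x0" "q \<in> dirs V x0" "x0 + unit_vec p + unit_vec r \<in> V"
        using mem x(1,2,3) by (simp_all add: dirs_def)
      ultimately show False
        using assms mem(1) unfolding square_free_def by blast
    qed
    moreover have "length c \<ge> 3" "even (length c)"
      using c even_length_cycle by (auto simp: cycle_def)
    ultimately have "length c \<ge> 6"
      by presburger
    then show ?thesis
      by (metis enat_ord_simps(1) numeral_eq_enat)
  qed
  then show ?thesis
    unfolding girth_def by (intro INF_greatest) simp
qed

section \<open>Directions at adjacent vertices\<close>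

lemma square_free_dirs:
  fixes V :: "(int ^ 'n) set"
  assumes sf: "square_free V" and reg: "\<And>v. v \<in> V \<Longrightarrow> card (dirs V v) = k"
    and k: "k > CARD('n)" and v: "v \<in> V" and d: "(i, b) \<in> dirs V v"
  shows "k = CARD('n) + 1" "(i, \<not> b) \<in> dirs V v"
    "dirs V (v + unit_vec (i, b)) = {(i, b), (i, \<not> b)} \<union> - dirs V v"
proof -
  let ?w = "v + unit_vec (i, b)" and ?P = "{(i, b), (i, \<not> b)}"
  have w: "?w \<in> V"
    using d by (simp add: dirs_def)
  \<comment> \<open>A common direction on another axis would complete a unit square on the edge from
    \<open>v\<close> to \<open>?w\<close>.\<close>
  have int: "dirs V v \<inter> dirs V ?w \<subseteq> ?P"
  proof
    fix e assume "e \<in> dirs V v \<inter> dirs V ?w"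
    then have "fst e = i"
      using sf v d unfolding square_free_def by (metis IntD1 IntD2 dirs_def fst_conv mem_Collect_eq)
    then show "e \<in> ?P"
      by (cases e) auto
  qed
  have "card (dirs V v) + card (dirs V ?w) = card (dirs V v \<union> dirs V ?w) + card (dirs V v \<inter> dirs V ?w)"
    by (intro card_Un_Int) auto
  then have sum: "2 * k = card (dirs V v \<union> dirs V ?w) + card (dirs V v \<inter> dirs V ?w)"
    using reg v w by simp
  have P: "card ?P = 2"
    by simp
  have le2: "card (dirs V v \<inter> dirs V ?w) \<le> card ?P"
    using int by (intro card_mono) auto
  have U: "card (UNIV :: ('n \<times> bool) set) = 2 * CARD('n)"
    by (simp add: card_cartesian_product flip: UNIV_Times_UNIV)
  have leU: "card (dirs V v \<union> dirs V ?w) \<le> card (UNIV :: ('n \<times> bool) set)"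
    by (intro card_mono) auto
  show "k = CARD('n) + 1"
    using sum le2 leU k unfolding P U by linarith
  \<comment> \<open>Since \<open>k > CARD('n)\<close>, the sum \<open>2 * k\<close> is at least 2n +
    2, the total of the two upper bounds, so both bounds are attained.\<close>
  have intP: "dirs V v \<inter> dirs V ?w = ?P"
    using int sum le2 leU k unfolding P U by (intro card_subset_eq) (auto simp: P[simplified])
  have un: "dirs V v \<union> dirs V ?w = UNIV"
    using sum le2 leU k unfolding P U by (intro card_subset_eq) (auto simp: U)
  show "(i, \<not> b) \<in> dirs V v"
    using intP by blast
  show "dirs V ?w = ?P \<union> - dirs V v"
    using intP un by blast
qed

section \<open>The middle layers and their girth\<close>

text \<open>The residue of \<open>v - z\<close> modulo 2, viewed as a vertex of the cube, that is,
  as a set of axes. A step of either sign along an axis toggles that axis.\<close>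

definition odds :: "int ^ 'n \<Rightarrow> int ^ 'n \<Rightarrow> 'n set" where
  "odds z v = {i. odd (v $ i - z $ i)}"

lemma odds_step:
  "odds z (v + unit_vec (i, b)) = (if i \<in> odds z v then odds z v - {i} else insert i (odds z v))"
  by (auto simp: odds_def)

lemma card_odds_step:
  "i \<in> odds z v \<Longrightarrow> Suc (card (odds z (v + unit_vec (i, b)))) = card (odds z v)"
  "i \<notin> odds z v \<Longrightarrow> card (odds z (v + unit_vec (i, b))) = Suc (card (odds z v))"
  by (simp_all only: odds_step if_True if_False card_Suc_Diff1[OF finite]) simp

text \<open>Modulo 2 and up to translation, these are the two middle layers of the cube of dimension
  \<open>2 m - 1\<close>.\<close>

definition middle :: "nat \<Rightarrow> int ^ 'n \<Rightarrow> (int ^ 'n) set" where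
  "middle m z = {v. card (odds z v) = m \<or> Suc (card (odds z v)) = m}"

lemma exists_odds: "\<exists>v. odds z v = A"
proof
  show "odds z (\<chi> i. z $ i + (if i \<in> A then 1 else 0)) = A"
    by (auto simp: odds_def)
qed

text \<open>From the upper layer only steps that remove an axis stay inside, from the lower layer
  only steps that add one. The sign does not matter modulo 2.\<close>

lemma dirs_middle:
  "card (odds z v) = m \<Longrightarrow> dirs (middle m z) v = odds z v \<times> UNIV"
  "Suc (card (odds z v)) = m \<Longrightarrow> dirs (middle m z) v = (- odds z v) \<times> UNIV"
proof -
  have mem: "(i, b) \<in> dirs (middle m z) v \<longleftrightarrow> (if i \<in> odds z v
      then card (odds z v) = Suc m \<or> card (odds z v) = m
      else Suc (card (odds z v)) = m \<or> Suc (Suc (card (odds z v))) = m)" for i b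
    using card_odds_step[of i z v b] by (auto simp: dirs_def middle_def)
  then show "card (odds z v) = m \<Longrightarrow> dirs (middle m z) v = odds z v \<times> UNIV"
    "Suc (card (odds z v)) = m \<Longrightarrow> dirs (middle m z) v = (- odds z v) \<times> UNIV"
    by (auto split: if_splits)
qed

text \<open>With n = 2m - 1 there are m usable axes in either layer, since n - (m - 1) = m, and each
  gives two directions.\<close>

lemma card_dirs_middle:
  fixes z :: "int ^ 'n"
  assumes m: "CARD('n) + 1 = 2 * m" and v: "v \<in> middle m z"
  shows "card (dirs (middle m z) v) = CARD('n) + 1"
proof -
  have "card (- odds z v) = CARD('n) - card (odds z v)"
    by (simp add: Compl_eq_Diff_UNIV card_Diff_subset)
  then show ?thesis
    using v m dirs_middle[of z v m] by (auto simp: middle_def card_cartesian_product)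
qed

text \<open>Two steps available at the same vertex go the same way, both down or both up. Taken
  together along different axes they overshoot the other layer.\<close>

lemma square_free_middle: "square_free (middle m z)"
  unfolding square_free_def
proof (intro ballI impI)
  fix v d e
  assume v: "v \<in> middle m z" and de: "d \<in> dirs (middle m z) v" "e \<in> dirs (middle m z) v"
    and ne: "fst d \<noteq> fst e"
  obtain i b j c where [simp]: "d = (i, b)" "e = (j, c)"
    by fastforce
  from v consider "card (odds z v) = m" | "Suc (card (odds z v)) = m"
    by (auto simp: middle_def)
  then show "v + unit_vec d + unit_vec e \<notin> middle m z"
  proof cases
    case 1
    then have "i \<in> odds z v" "j \<in> odds z v"
      using de by (auto simp: dirs_middle)
    moreover from this have "j \<in> odds z (v + unit_vec d)"
      using ne by (simp add: odds_step)
    ultimately have "Suc (card (odds z (v + unit_vec d))) = m"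
      "Suc (card (odds z (v + unit_vec d + unit_vec e))) = card (odds z (v + unit_vec d))"
      using card_odds_step(1) 1 by fastforce+
    then show ?thesis
      by (auto simp: middle_def)
  next
    case 2
    then have "i \<notin> odds z v" "j \<notin> odds z v"
      using de by (auto simp: dirs_middle)
    moreover from this have "j \<notin> odds z (v + unit_vec d)"
      using ne by (simp add: odds_step)
    ultimately have "card (odds z (v + unit_vec d)) = m"
      "card (odds z (v + unit_vec d + unit_vec e)) = Suc (card (odds z (v + unit_vec d)))"
      using card_odds_step(2) 2 by fastforce+
    then show ?thesis
      by (auto simp: middle_def)
  qed
qed

lemma girth_middle:
  fixes z :: "int ^ 'n"
  assumes m: "CARD('n) + 1 = 2 * m" and m2: "m \<ge> 2"
  shows "girth (spanned (middle m z)) = 6"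
proof (rule antisym)
  obtain A :: "'n set" where A: "card A = m"
    using obtain_subset_with_card_n[of m "UNIV :: 'n set"] m m2 by auto
  obtain v where v: "odds z v = A"
    using exists_odds by blast
  obtain i j where ij: "i \<in> A" "j \<in> A" "i \<noteq> j"
    using A m2 by (metis card_le_Suc0_iff_eq card.infinite finite not_less_eq_eq numeral_2_eq_2)
  have "A \<noteq> UNIV"
    using A m m2 by auto
  then obtain l where l: "l \<notin> A"
    by blast
  define e where "e x = unit_vec (x, True)" for x :: 'n
  \<comment> \<open>The steps are +i, +l, +j, -i, -l, -j. Removing \<open>i\<close>, adding
    \<open>l\<close> and removing \<open>j\<close>, then undoing this in the same order, alternates
    between sizes m and m - 1.\<close>
  let ?c = "[v, v + e i, v + e i + e l, v + e i + e l + e j, v + e l + e j, v + e j]"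
  have odds: "odds z v = A" "odds z (v + e i) = A - {i}" "odds z (v + e j) = A - {j}"
    "odds z (v + e i + e l) = insert l (A - {i})"
    "odds z (v + e i + e l + e j) = insert l (A - {i} - {j})"
    "odds z (v + e l + e j) = insert l (A - {j})"
    using ij l v unfolding e_def by (auto simp: odds_step)
  have "set ?c \<subseteq> middle m z"
    using A ij l m2 by (auto simp: middle_def odds card_Diff_singleton)
  \<comment> \<open>The six vertices are distinct already modulo 2.\<close>
  moreover have "distinct (map (odds z) ?c)"
    by (simp add: odds) (intro conjI; use ij l in \<open>metis Diff_iff insert_iff empty_iff\<close>)
  then have "distinct ?c"
    using distinct_map by blast
  moreover have "lattice_dist (v + e i + e l + e j) (v + e l + e j) = 1"
    using lattice_dist_unit_vec(2)[of "v + e l + e j" "(i, True)"] by (simp add: e_def ac_simps)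
  moreover have "lattice_dist (v + e l + e j) (v + e j) = 1"
    using lattice_dist_unit_vec(2)[of "v + e j" "(l, True)"] by (simp add: e_def ac_simps)
  ultimately have "cycle (spanned (middle m z)) ?c"
    by (intro cycle_spannedI) (simp_all add: e_def)
  moreover have "enat (length ?c) = 6"
    by (simp add: numeral_eq_enat)
  ultimately show "girth (spanned (middle m z)) \<le> 6"
    using girth_le by metis
qed (rule square_free_girth_ge_6[OF square_free_middle])

section \<open>Uniqueness of the square-free sets\<close>

text \<open>Opposite directions occur together, so the axis sets \<open>S v\<close> carry all local
  information. An invariant spreads from one vertex over a whole copy of the middle layers. As
  \<open>V\<close> need not be connected, a separate argument shows that it has no further
  vertices.\<close>

lemma square_free_eq_middle:
  fixes V :: "(int ^ 'n) set"
  assumes sf: "square_free V" and ne: "V \<noteq> {}"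
    and reg: "\<And>v. v \<in> V \<Longrightarrow> card (dirs V v) = k" and k: "k > CARD('n)"
  obtains m z where "k = CARD('n) + 1" "CARD('n) + 1 = 2 * m" "V = middle m z"
proof -
  define S where "S v = fst ` dirs V v" for v
  obtain v0 where v0: "v0 \<in> V"
    using ne by blast
  then have "dirs V v0 \<noteq> {}"
    using reg k by fastforce
  then have kn: "k = CARD('n) + 1"
    using square_free_dirs(1)[OF sf _ k v0] reg by auto
  have opp: "(i, \<not> b) \<in> dirs V v"
    and dirs_step: "dirs V (v + unit_vec (i, b)) = {(i, b), (i, \<not> b)} \<union> - dirs V v"
    if "v \<in> V" "(i, b) \<in> dirs V v" for v i b
    using square_free_dirs(2,3)[OF sf _ k that] reg by blast+
  have dirs: "dirs V v = S v \<times> UNIV" if "v \<in> V" for v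
  proof -
    have "(i, c) \<in> dirs V v" if "(i, b) \<in> dirs V v" for i b c
      using opp[OF \<open>v \<in> V\<close> that] that by (cases "b = c") auto
    then show ?thesis
      by (force simp: S_def)
  qed
  define m where "m = card (S v0)"
  have m: "CARD('n) + 1 = 2 * m"
    using reg[OF v0] dirs[OF v0] kn by (simp add: m_def card_cartesian_product)
  have cardS: "card (S v) = m" if "v \<in> V" for v
    using reg[OF that] dirs[OF that] kn m by (simp add: card_cartesian_product)
  have stepV: "v + unit_vec (i, b) \<in> V \<longleftrightarrow> i \<in> S v" if "v \<in> V" for v i b
    using dirs[OF that] by (auto simp: dirs_def)
  have S_step: "S (v + unit_vec (i, b)) = insert i (- S v)" if "v \<in> V" "i \<in> S v" for v i b
  proof -
    have "(i, b) \<in> dirs V v"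
      using dirs that by auto
    note dirs_step[OF \<open>v \<in> V\<close> this]
    moreover have "v + unit_vec (i, b) \<in> V"
      using stepV that by blast
    ultimately have "S (v + unit_vec (i, b)) \<times> UNIV = {(i, b), (i, \<not> b)} \<union> - (S v \<times> UNIV)"
      using dirs that(1) by metis
    then have "j \<in> S (v + unit_vec (i, b)) \<longleftrightarrow> (j, b) \<in> {(i, b), (i, \<not> b)} \<union> - (S v \<times> UNIV)" for j
      by (metis UNIV_I mem_Sigma_iff)
    then show ?thesis
      by auto
  qed

  text \<open>The base point \<open>z\<close> is chosen such that \<open>v0\<close> lies in the upper layer and its axes are
    those along which one can step down.\<close>

  define z where "z = v0 - (\<chi> i. if i \<in> S v0 then 1 else 0)"
  have z: "odds z v0 = S v0"
    by (auto simp: odds_def z_def)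
  \<comment> \<open>The invariant: \<open>v\<close> is a vertex of \<open>V\<close> in one of the
    two layers, and its axes are those that it would have in \<open>middle m z\<close>.\<close>
  define P where "P v \<longleftrightarrow> v \<in> V \<and> v \<in> middle m z \<and>
    (card (odds z v) = m \<longrightarrow> S v = odds z v) \<and> (Suc (card (odds z v)) = m \<longrightarrow> S v = - odds z v)" for v
  have P0: "P v0"
    using v0 z by (auto simp: P_def middle_def m_def)
  \<comment> \<open>Passing to \<open>insert i (- S v)\<close> turns the axes of one layer into
    those of the other, so the invariant survives. The new layer is recorded as well, so that steps
    can be chained.\<close>
  have down: "P (v + unit_vec (i, b))" "Suc (card (odds z (v + unit_vec (i, b)))) = m"
    if "P v" "card (odds z v) = m" "i \<in> odds z v" for v i b
  proof -
    have "v \<in> V" "S v = odds z v"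
      using that by (auto simp: P_def)
    moreover show "Suc (card (odds z (v + unit_vec (i, b)))) = m"
      using that card_odds_step by metis
    ultimately show "P (v + unit_vec (i, b))"
      using that stepV[of v i b] S_step[of v i b] by (auto simp: P_def middle_def odds_step)
  qed
  have up: "P (v + unit_vec (i, b))" "card (odds z (v + unit_vec (i, b))) = m"
    if "P v" "Suc (card (odds z v)) = m" "i \<notin> odds z v" for v i b
  proof -
    have "v \<in> V" "S v = - odds z v"
      using that by (auto simp: P_def)
    moreover show "card (odds z (v + unit_vec (i, b))) = m"
      using that card_odds_step by metis
    ultimately show "P (v + unit_vec (i, b))"
      using that stepV[of v i b] S_step[of v i b] by (auto simp: P_def middle_def odds_step)
  qed
  \<comment> \<open>Induction on the l1-distance from \<open>v\<close> to \<open>w\<close>, moving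
    within the upper layer. A coordinate that is off by at least 2 is shifted by 2; once all are off
    by at most 1, an odd axis of \<open>v\<close> is exchanged for one of \<open>w\<close>.\<close>
  have upper: "P w" if "P v" "card (odds z v) = m" "card (odds z w) = m" for v w
    using that(1,2)
  proof (induction "nat (\<Sum>i\<in>UNIV. \<bar>w $ i - v $ i\<bar>)" arbitrary: v rule: less_induct)
    case less
    have closer: "nat (\<Sum>i\<in>UNIV. \<bar>w $ i - v' $ i\<bar>) < nat (\<Sum>i\<in>UNIV. \<bar>w $ i - v $ i\<bar>)"
      if "\<And>i. \<bar>w $ i - v' $ i\<bar> \<le> \<bar>w $ i - v $ i\<bar>" "\<bar>w $ j - v' $ j\<bar> < \<bar>w $ j - v $ j\<bar>" for v' j
    proof -
      have "(\<Sum>i\<in>UNIV. \<bar>w $ i - v' $ i\<bar>) < (\<Sum>i\<in>UNIV. \<bar>w $ i - v $ i\<bar>)"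
        using that by (intro sum_strict_mono_ex1) auto
      moreover have "0 \<le> (\<Sum>i\<in>UNIV. \<bar>w $ i - v' $ i\<bar>)"
        by (simp add: sum_nonneg)
      ultimately show ?thesis
        by (simp only: nat_less_eq_zless)
    qed
    show ?case
    proof (cases "\<exists>i. \<bar>w $ i - v $ i\<bar> \<ge> 2")
      case True
      then obtain i where i: "\<bar>w $ i - v $ i\<bar> \<ge> 2" ..
      define u where "u = unit_vec (i, w $ i > v $ i)"
      let ?v = "v + u + u"
      have odds': "odds z ?v = odds z v"
        by (auto simp: odds_def u_def)
      have "P ?v"
      proof (cases "i \<in> odds z v")
        case True
        then have "i \<notin> odds z (v + u)"
          by (simp add: u_def odds_step)
        then show ?thesis
          using down[OF less.prems True] up unfolding u_def by blast
      next
        case False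
        \<comment> \<open>Here a step along \<open>i\<close> would leave the layers upwards. A
          detour makes room: first down along another axis \<open>j\<close>, then up and down along
          \<open>i\<close>, then back along \<open>j\<close>.\<close>
        have "odds z v \<noteq> {}"
          using less.prems(2) m by auto
        then obtain j where j: "j \<in> odds z v"
          by blast
        let ?e = "unit_vec (j, True)"
        have ij: "i \<noteq> j"
          using j False by blast
        have flips: "i \<notin> odds z (v + ?e)" "i \<in> odds z (v + ?e + u)" "j \<notin> odds z (v + ?e + u + u)"
          using False j ij by (auto simp: u_def odds_def)
        have 1: "P (v + ?e)" "Suc (card (odds z (v + ?e))) = m"
          using down[OF less.prems j] by blast+
        have 2: "P (v + ?e + u)" "card (odds z (v + ?e + u)) = m"
          using up 1 flips(1) unfolding u_def by blast+
        have 3: "P (v + ?e + u + u)" "Suc (card (odds z (v + ?e + u + u))) = m"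
          using down 2 flips(2) unfolding u_def by blast+
        have "P (v + ?e + u + u + unit_vec (j, False))"
          using up 3 flips(3) by blast
        then show ?thesis
          using unit_vec_opposite[of j True] by (simp add: algebra_simps)
      qed
      moreover have "nat (\<Sum>j\<in>UNIV. \<bar>w $ j - ?v $ j\<bar>) < nat (\<Sum>j\<in>UNIV. \<bar>w $ j - v $ j\<bar>)"
        using i by (intro closer[of _ i]) (auto simp: u_def)
      ultimately show ?thesis
        using less.hyps[of ?v] less.prems(2) odds' by metis
    next
      case False
      then have near: "\<bar>w $ i - v $ i\<bar> \<le> 1" for i
      proof -
        have "\<not> 2 \<le> \<bar>w $ i - v $ i\<bar>"
          using False by blast
        then show ?thesis
          by linarith
      qed
      show ?thesis
      proof (cases "w = v")
        case neq: False
        have "odds z w \<noteq> odds z v"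
        proof
          assume eq: "odds z w = odds z v"
          have "w $ i = v $ i" for i
          proof -
            have "even (w $ i - v $ i)"
              using eq by (auto simp: odds_def set_eq_iff)
            then show ?thesis
              using near[of i] by presburger
          qed
          then show False
            using neq by (simp add: vec_eq_iff)
        qed
        \<comment> \<open>Different sets of the same size m: neither contains the other.\<close>
        then have "\<not> odds z v \<subseteq> odds z w" "\<not> odds z w \<subseteq> odds z v"
          using less.prems(2) that(3) card_subset_eq[of "odds z v" "odds z w"]
            card_subset_eq[of "odds z w" "odds z v"] by auto
        then obtain i j where i: "i \<in> odds z v" "i \<notin> odds z w" and j: "j \<in> odds z w" "j \<notin> odds z v"
          by blast
        then have ij: "i \<noteq> j" and di: "w $ i \<noteq> v $ i" and dj: "w $ j \<noteq> v $ j"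
          by (auto simp: odds_def)
        let ?v1 = "v + unit_vec (i, w $ i > v $ i)"
        let ?v2 = "?v1 + unit_vec (j, w $ j > v $ j)"
        have 1: "P ?v1" "Suc (card (odds z ?v1)) = m"
          using down less.prems i(1) by blast+
        have "j \<notin> odds z ?v1"
          using i j by (simp add: odds_step)
        then have 2: "P ?v2" "card (odds z ?v2) = m"
          using up 1 by blast+
        have "nat (\<Sum>l\<in>UNIV. \<bar>w $ l - ?v2 $ l\<bar>) < nat (\<Sum>l\<in>UNIV. \<bar>w $ l - v $ l\<bar>)"
          using di dj ij by (intro closer[of _ i]) auto
        then show ?thesis
          using less.hyps 2 by blast
      qed (use less.prems in simp)
    qed
  qed
  have P_middle: "P w" if w: "w \<in> middle m z" for w
  proof (cases "card (odds z w) = m")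
    case True
    then show ?thesis
      using upper P0 z m_def by metis
  next
    case False
    then have cw: "Suc (card (odds z w)) = m"
      using w by (simp add: middle_def)
    then have "odds z w \<noteq> UNIV"
      using m by auto
    then obtain i where i: "i \<notin> odds z w"
      by blast
    \<comment> \<open>A lower vertex is reached by one step down from this upper neighbour.\<close>
    let ?v = "w + unit_vec (i, True)"
    have v: "card (odds z ?v) = m"
      using i cw card_odds_step by metis
    then have "P ?v"
      using upper P0 z m_def by metis
    moreover have "i \<in> odds z ?v"
      using i by (simp add: odds_step)
    ultimately have "P (?v + unit_vec (i, False))"
      using down v by blast
    then show ?thesis
      using unit_vec_opposite[of i True] by simp
  qed
  have S_back: "i \<in> S (v + unit_vec (i, b))" if "v \<in> V" "i \<in> S v" for v i b
    using S_step that by blast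

  text \<open>Since \<open>S v\<close> contains more than half of the axes, a vertex outside the two layers could
    step towards them inside \<open>V\<close>, whereas no step inside \<open>V\<close> leads out of them.\<close>

  have meet: "\<exists>i. i \<in> S v \<and> i \<in> A" if "v \<in> V" "card A \<ge> m" for v A
  proof (rule ccontr)
    assume "\<not> ?thesis"
    then have "card (S v \<union> A) = card (S v) + card A"
      by (intro card_Un_disjoint) auto
    moreover have "card (S v \<union> A) \<le> CARD('n)"
      by (intro card_mono) auto
    ultimately show False
      using cardS that m by auto
  qed
  have above: "card (odds z v) \<le> m" if "v \<in> V" for v
    using that
  proof (induction "card (odds z v)" arbitrary: v rule: less_induct)
    case less
    show ?case
    proof (rule ccontr)
      assume gt: "\<not> card (odds z v) \<le> m"
      then obtain i where i: "i \<in> S v" "i \<in> odds z v"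
        using meet less.prems by (meson nat_le_linear)
      let ?w = "v + unit_vec (i, True)"
      have w: "?w \<in> V" "Suc (card (odds z ?w)) = card (odds z v)"
        using stepV less.prems i card_odds_step by blast+
      then have "card (odds z ?w) = m"
        using less.hyps[of ?w] gt by linarith
      \<comment> \<open>At \<open>?w\<close>, in the upper layer, all edges of \<open>V\<close> lead
        down, whereas the edge back to \<open>v\<close> leads up.\<close>
      then have "S ?w = odds z ?w"
        using P_middle[of ?w] by (simp add: P_def middle_def)
      then show False
        using S_back less.prems i by (auto simp: odds_step)
    qed
  qed
  have below: "m \<le> Suc (card (odds z v))" if "v \<in> V" for v
    using that
  proof (induction "m - card (odds z v)" arbitrary: v rule: less_induct)
    case less
    show ?case
    proof (rule ccontr)
      assume lt: "\<not> m \<le> Suc (card (odds z v))"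
      have "card (- odds z v) = CARD('n) - card (odds z v)"
        by (simp add: Compl_eq_Diff_UNIV card_Diff_subset)
      then have "card (- odds z v) \<ge> m"
        using lt m by linarith
      then obtain i where i: "i \<in> S v" "i \<notin> odds z v"
        using meet less.prems by blast
      let ?w = "v + unit_vec (i, True)"
      have w: "?w \<in> V" "card (odds z ?w) = Suc (card (odds z v))"
        using stepV less.prems i card_odds_step by blast+
      then have "Suc (card (odds z ?w)) = m"
        using less.hyps[of ?w] lt by linarith
      then have "S ?w = - odds z ?w"
        using P_middle[of ?w] by (simp add: P_def middle_def)
      then show False
        using S_back less.prems i by (auto simp: odds_step)
    qed
  qed
  have "V = middle m z"
  proof
    show "V \<subseteq> middle m z"
      using above below by (fastforce simp: middle_def)
    show "middle m z \<subseteq> V"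
      using P_middle by (auto simp: P_def)
  qed
  then show thesis
    using that kn m by blast
qed

text \<open>Translation by \<open>z' - z\<close> carries residues relative to \<open>z\<close> to
  residues relative to \<open>z'\<close>.\<close>

lemma same_up_to_isometry_middle:
  "same_up_to_isometry (spanned (middle m z)) (spanned (middle m z'))"
proof -
  define f where "f = (\<lambda>v. v + (z' - z))"
  have bij: "bij f"
    unfolding f_def by (rule bij_plus_right)
  have dist: "lattice_dist (f x) (f y) = lattice_dist x y" for x y
    by (simp add: f_def lattice_dist_def dist_vec_def dist_real_def L2_set_def)
  have "odds z' (f v) = odds z v" for v
    by (simp add: f_def odds_def)
  then have mem: "f v \<in> middle m z' \<longleftrightarrow> v \<in> middle m z" for v
    by (simp add: middle_def)
  have surj: "\<exists>x. y = f x" for y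
    using bij by (metis bij_pointE)
  have verts: "middle m z' = f ` middle m z"
    using mem surj by (auto, metis imageI)
  have "edges (spanned (middle m z')) = (\<lambda>e. f ` e) ` edges (spanned (middle m z))"
  proof (intro set_eqI iffI)
    fix e assume "e \<in> edges (spanned (middle m z'))"
    then obtain x y where "e = {x, y}" "x \<in> middle m z'" "y \<in> middle m z'" "lattice_dist x y = 1"
      by (auto simp: spanned_def)
    moreover obtain x' y' where "x = f x'" "y = f y'"
      using surj by metis
    ultimately have "e = f ` {x', y'}" "{x', y'} \<in> edges (spanned (middle m z))"
      using mem dist by (auto simp: spanned_def)
    then show "e \<in> (\<lambda>e. f ` e) ` edges (spanned (middle m z))"
      by blast
  next
    fix e assume "e \<in> (\<lambda>e. f ` e) ` edges (spanned (middle m z))"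
    then obtain x y where "e = f ` {x, y}" "x \<in> middle m z" "y \<in> middle m z" "lattice_dist x y = 1"
      by (auto simp: spanned_def)
    then have "e = {f x, f y}" "f x \<in> middle m z'" "f y \<in> middle m z'" "lattice_dist (f x) (f y) = 1"
      using mem dist by auto
    then show "e \<in> edges (spanned (middle m z'))"
      unfolding spanned_def graph.sel by blast
  qed
  then show ?thesis
    unfolding same_up_to_isometry_def isometry_def using bij dist verts by auto
qed

section \<open>Examples of girth 4\<close>

definition slab :: "'n set \<Rightarrow> (int ^ 'n) set" where
  "slab A = {v. \<forall>i. i \<notin> A \<longrightarrow> v $ i \<in> {0, 1}}"

text \<open>An axis in \<open>A\<close> is free and contributes both directions. On any other axis
  the only possible step goes to the other element of {0, 1}. The degree is thus 2|A| + (n -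
  |A|).\<close>

lemma card_dirs_slab:
  fixes A :: "'n::finite set"
  assumes "v \<in> slab A"
  shows "card (dirs (slab A) v) = CARD('n) + card A"
proof -
  have "(i, b) \<in> dirs (slab A) v \<longleftrightarrow> i \<in> A \<or> b = (v $ i = 0)" for i b
    using assms by (force simp: dirs_def slab_def)
  then have "dirs (slab A) v = A \<times> UNIV \<union> (\<lambda>i. (i, v $ i = 0)) ` (- A)"
    by force
  moreover have "card (A \<times> (UNIV :: bool set) \<union> (\<lambda>i. (i, v $ i = 0)) ` (- A)) = 2 * card A + card (- A)"
    by (subst card_Un_disjoint) (auto simp: card_cartesian_product card_image inj_on_def)
  moreover have "card A \<le> CARD('n)"
    by (intro card_mono) auto
  ultimately show ?thesis
    by (simp add: Compl_eq_Diff_UNIV card_Diff_subset)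
qed

section \<open>The maximal girth\<close>

theorem theorem1:
  fixes n k :: nat
  assumes "CARD('n::finite) = n" and "n \<ge> 2" and "k > n"
  shows "if odd n \<and> k = n + 1
    then is_maximal_girth (regular_induced_subgraphs (grid :: (int ^ 'n) graph) k) 6 \<and>
      (\<exists>H \<in> regular_induced_subgraphs (grid :: (int ^ 'n) graph) k. girth H = 6 \<and>
        (\<forall>H' \<in> regular_induced_subgraphs (grid :: (int ^ 'n) graph) k.
           girth H' = 6 \<longrightarrow> same_up_to_isometry H H'))
    else k \<le> 2 * n \<longrightarrow>
      is_maximal_girth (regular_induced_subgraphs (grid :: (int ^ 'n) graph) k) 4"
proof (cases "odd n \<and> k = n + 1")
  case True
  let ?R = "regular_induced_subgraphs (grid :: (int ^ 'n) graph) k"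
  obtain m where m: "n + 1 = 2 * m"
    using True by (metis dvdE even_add odd_one)
  let ?M = "spanned (middle m (0 :: int ^ 'n))"
  have m2: "m \<ge> 2"
    using m assms(2) by linarith
  have "card (UNIV :: 'n set) \<ge> m"
    using assms(1) m m2 by linarith
  then obtain A :: "'n set" where "card A = m"
    using obtain_subset_with_card_n by blast
  then have "middle m (0 :: int ^ 'n) \<noteq> {}"
    using exists_odds[of "0 :: int ^ 'n" A] by (auto simp: middle_def)
  then have M: "?M \<in> ?R"
    unfolding regular_induced_subgraphs_grid
    using card_dirs_middle[of m _ "0 :: int ^ 'n"] m True assms(1) by (intro imageI) auto
  have g: "girth (spanned (middle m z)) = 6" for z :: "int ^ 'n"
    using girth_middle m m2 assms(1) by blast
  \<comment> \<open>The alternatives are whether or not the vertex set contains a unit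
    square.\<close>
  have cases: "girth H \<le> 4 \<or> (\<exists>z. H = spanned (middle m z))" if H: "H \<in> ?R" for H
  proof -
    obtain V where V: "H = spanned V" "V \<noteq> {}" "\<And>v. v \<in> V \<Longrightarrow> card (dirs V v) = k"
      using H by (auto simp: regular_induced_subgraphs_grid)
    show ?thesis
    proof (cases "square_free V")
      case sf: True
      have "k > CARD('n)"
        using assms by simp
      then obtain m' z where "CARD('n) + 1 = 2 * m'" "V = middle m' z"
        using square_free_eq_middle[OF sf V(2,3)] by metis
      then show ?thesis
        using V(1) m assms(1) by auto
    qed (use not_square_free_girth_le_4 V in blast)
  qed
  have le: "girth H \<le> 6" if "H \<in> ?R" for H
    using cases[OF that] g order_trans[of "girth H" 4 6] by auto
  have iso: "same_up_to_isometry ?M H" if "H \<in> ?R" "girth H = 6" for H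
    using cases[OF that(1)] that(2) same_up_to_isometry_middle by fastforce
  show ?thesis
    using True M g le iso by (auto simp: is_maximal_girth_def)
next
  case False
  have le: "girth H \<le> 4" if H: "H \<in> regular_induced_subgraphs (grid :: (int ^ 'n) graph) k" for H
  proof -
    obtain V where V: "H = spanned V" "V \<noteq> {}" "\<And>v. v \<in> V \<Longrightarrow> card (dirs V v) = k"
      using H by (auto simp: regular_induced_subgraphs_grid)
    \<comment> \<open>Without unit squares, \<open>k\<close> would be n + 1 and n + 1 would be even,
      which is the case excluded here.\<close>
    have "\<not> square_free V"
    proof
      assume sf: "square_free V"
      have "k > CARD('n)"
        using assms by simp
      then obtain m z where "k = CARD('n) + 1" "CARD('n) + 1 = 2 * m"
        using square_free_eq_middle[OF sf V(2,3)] by metis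
      then show False
        using False assms(1) by (metis even_Suc Suc_eq_plus1 dvd_triv_left)
    qed
    then show ?thesis
      using not_square_free_girth_le_4 V(1) by blast
  qed
  have "is_maximal_girth (regular_induced_subgraphs (grid :: (int ^ 'n) graph) k) 4" if "k \<le> 2 * n"
  proof -
    \<comment> \<open>The degree n + |A| of the slab has to be \<open>k\<close>; enough axes exist
      because \<open>k\<close> is at most 2n.\<close>
    have "k - n \<le> card (UNIV :: 'n set)"
      using that assms(1) by simp
    then obtain A :: "'n set" where A: "card A = k - n"
      using obtain_subset_with_card_n by blast
    have "0 \<in> slab A"
      by (simp add: slab_def)
    moreover have "card (dirs (slab A) v) = k" if "v \<in> slab A" for v
      using card_dirs_slab[OF that] A assms by simp
    ultimately have "spanned (slab A) \<in> regular_induced_subgraphs (grid :: (int ^ 'n) graph) k"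
      by (auto simp: regular_induced_subgraphs_grid)
    moreover from this have "girth (spanned (slab A)) = 4"
      using le girth_spanned_ge_4 by (intro antisym) auto
    ultimately show ?thesis
      using le by (auto simp: is_maximal_girth_def)
  qed
  then show ?thesis
    unfolding if_not_P[OF False] by blast
qed

end
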